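(* Let $R$ be a ring. Let $\mathrm{cl}$ be an openly persistent preclosure operation on submodules (respectively, on ideals) over $\operatorname{Spec}R$ that commutes with localizations at single elements. Then $\mathrm{cl}$ is glueable over $R$.
   Context: All rings are commutative with $1$. A preclosure operation on a poset is an extensive ($s\le s^{\mathrm{cl}}$) and order-preserving self-map. A preclosure operation $\mathrm{cl}$ on submodules (resp. ideals) over $\operatorname{Spec}R$ gives, for every affine open $U=\operatorname{Spec}S\subseteq\operatorname{Spec}R$ and every $S$-module $M$, a preclosure operation $L\mapsto L^{\mathrm{cl}}_M$ on the $S$-submodules of $M$ (resp. a preclosure operation $I\mapsto I^{\mathrm{cl}}$ on the ideals of $S$). Canonically isomorphic modules are identified (so the operation is understood to be compatible with isomorphisms); $R_f$ is the ring of the affine open $D(f)$. Openly persistent: for every affine open $\operatorname{Spec}S\subseteq\operatorname{Spec}R$ with ring map $\varphi:R\to S$, all $R$-modules $L\subseteq M$ and $x\in L^{\mathrm{cl}}_M$, we have $x\otimes1\in(LS)^{\mathrm{cl}}_{M\otimes_RS}$, where $LS$ is the image of $L\otimes_RS\to M\otimes_RS$ (resp. for every ideal $I$ of $R$ and $x\in I^{\mathrm{cl}}$, $\varphi(x)\in(IS)^{\mathrm{cl}}$). Commutes with localizations at single elements: for every $f\in R$ and all $R$-modules $L\subseteq M$, $(L_f)^{\mathrm{cl}}_{M_f}=(L^{\mathrm{cl}}_M)_f$ (resp. for every ideal $I$ of $R$, $(I_f)^{\mathrm{cl}}=(I^{\mathrm{cl}})_f$). Glueable over $R$ (for an openly persistent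 preclosure operation): whenever $I$ is an ideal of $R$ with generating set $(f_\alpha)_{\alpha\in A}$, $g\in\sqrt I$, $L\subseteq M$ are $R$-modules (resp. $J$ is an ideal of $R$), and $z\in M$ (resp. $z\in R$) satisfies $z/1\in(L_{f_\alpha})^{\mathrm{cl}}_{M_{f_\alpha}}$ (resp. $z/1\in(J_{f_\alpha})^{\mathrm{cl}}$ in $R_{f_\alpha}$) for all $\alpha\in A$, it follows that $z/1\in(L_g)^{\mathrm{cl}}_{M_g}$ (resp. $z/1\in(J_g)^{\mathrm{cl}}$ in $R_g$). *)

theory Defs
  imports
    "HOL-Analysis.Abstract_Topology"
    "HOL-Algebra.Module"
    "HOL-Algebra.Ideal"
    "HOL-Algebra.RingHom"
    "HOL-Algebra.QuotRing"
    "HOL-Algebra.Coset"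
    "HOL-Algebra.Generated_Groups"
    "HOL-Algebra.Free_Abelian_Groups"
begin

section \<open>Localization\<close>

definition loc_frac :: "'a ring \<Rightarrow> 'a set \<Rightarrow> 'a \<Rightarrow> 'a \<Rightarrow> ('a \<times> 'a) set" where
  "loc_frac R W r s = {(r', s'). r' \<in> carrier R \<and> s' \<in> W \<and>
     (\<exists>u\<in>W. u \<otimes>\<^bsub>R\<^esub> (s' \<otimes>\<^bsub>R\<^esub> r) = u \<otimes>\<^bsub>R\<^esub> (s \<otimes>\<^bsub>R\<^esub> r'))}"

definition loc_ring :: "'a ring \<Rightarrow> 'a set \<Rightarrow> ('a \<times> 'a) set ring" where
  "loc_ring R W = \<lparr>
     carrier = {loc_frac R W r s | r s. r \<in> carrier R \<and> s \<in> W},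
     monoid.mult = (\<lambda>A B. \<Union>(r, s)\<in>A. \<Union>(r', s')\<in>B. loc_frac R W (r \<otimes>\<^bsub>R\<^esub> r') (s \<otimes>\<^bsub>R\<^esub> s')),
     monoid.one = loc_frac R W \<one>\<^bsub>R\<^esub> \<one>\<^bsub>R\<^esub>,
     ring.zero = loc_frac R W \<zero>\<^bsub>R\<^esub> \<one>\<^bsub>R\<^esub>,
     ring.add = (\<lambda>A B. \<Union>(r, s)\<in>A. \<Union>(r', s')\<in>B.
              loc_frac R W (s' \<otimes>\<^bsub>R\<^esub> r \<oplus>\<^bsub>R\<^esub> s \<otimes>\<^bsub>R\<^esub> r') (s \<otimes>\<^bsub>R\<^esub> s'))\<rparr>"

definition mod_frac :: "'a ring \<Rightarrow> 'a set \<Rightarrow> ('a, 'm) module \<Rightarrow> 'm \<Rightarrow> 'a \<Rightarrow> ('m \<times> 'a) set" where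
  "mod_frac R W M x s = {(x', s'). x' \<in> carrier M \<and> s' \<in> W \<and>
     (\<exists>u\<in>W. u \<odot>\<^bsub>M\<^esub> (s' \<odot>\<^bsub>M\<^esub> x) = u \<odot>\<^bsub>M\<^esub> (s \<odot>\<^bsub>M\<^esub> x'))}"

text \<open>The record type of modules extends that of rings; the fields \<open>mult\<close> and \<open>one\<close> of a module
  play no role in the locale \<open>module\<close> and are left unspecified here and below.\<close>

definition loc_mod :: "'a ring \<Rightarrow> 'a set \<Rightarrow> ('a, 'm) module \<Rightarrow> (('a \<times> 'a) set, ('m \<times> 'a) set) module"
  where
  "loc_mod R W M = \<lparr>
     carrier = {mod_frac R W M x s | x s. x \<in> carrier M \<and> s \<in> W},
     monoid.mult = undefined,
     monoid.one = undefined,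
     ring.zero = mod_frac R W M \<zero>\<^bsub>M\<^esub> \<one>\<^bsub>R\<^esub>,
     ring.add = (\<lambda>A B. \<Union>(x, s)\<in>A. \<Union>(x', s')\<in>B.
              mod_frac R W M (s' \<odot>\<^bsub>M\<^esub> x \<oplus>\<^bsub>M\<^esub> s \<odot>\<^bsub>M\<^esub> x') (s \<otimes>\<^bsub>R\<^esub> s')),
     module.smult = (\<lambda>A B. \<Union>(r, s)\<in>A. \<Union>(x, t)\<in>B. mod_frac R W M (r \<odot>\<^bsub>M\<^esub> x) (s \<otimes>\<^bsub>R\<^esub> t))\<rparr>"

definition loc_submod :: "'a ring \<Rightarrow> 'a set \<Rightarrow> ('a, 'm) module \<Rightarrow> 'm set \<Rightarrow> ('m \<times> 'a) set set" where
  "loc_submod R W M L = {mod_frac R W M x s | x s. x \<in> L \<and> s \<in> W}"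

definition loc_ideal :: "'a ring \<Rightarrow> 'a set \<Rightarrow> 'a set \<Rightarrow> ('a \<times> 'a) set set" where
  "loc_ideal R W I = {loc_frac R W r s | r s. r \<in> I \<and> s \<in> W}"

definition powers :: "'a ring \<Rightarrow> 'a \<Rightarrow> 'a set" where
  "powers R f = {f [^]\<^bsub>R\<^esub> n | n :: nat. True}"

section \<open>Affine open subschemes of a spectrum\<close>

definition Spec :: "'a ring \<Rightarrow> 'a set set" where
  "Spec R = {p. primeideal p R}"

definition zariski_open :: "'a ring \<Rightarrow> 'a set set \<Rightarrow> bool" where
  "zariski_open R U \<longleftrightarrow> (\<exists>E\<subseteq>carrier R. U = {p \<in> Spec R. \<not> E \<subseteq> p})"

definition zariski :: "'a ring \<Rightarrow> 'a set topology" where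
  "zariski R = topology (zariski_open R)"

definition contraction :: "'a ring \<Rightarrow> ('a \<Rightarrow> 'a) \<Rightarrow> 'a set \<Rightarrow> 'a set" where
  "contraction R \<phi> q = {r \<in> carrier R. \<phi> r \<in> q}"

definition stalk_map :: "'a ring \<Rightarrow> ('a \<Rightarrow> 'a) \<Rightarrow> 'a set \<Rightarrow> ('a \<times> 'a) set \<Rightarrow> ('a \<times> 'a) set" where
  "stalk_map S \<phi> q A = (\<Union>(r, s)\<in>A. loc_frac S (carrier S - q) (\<phi> r) (\<phi> s))"

text \<open>An affine open of \<open>Spec R\<close> is given by a ring map \<open>\<phi> : R \<rightarrow> S\<close> whose map on spectra is an
  open immersion: a homeomorphism onto an open subset, inducing isomorphisms on stalks.\<close>

definition affine_open :: "'a ring \<Rightarrow> 'a ring \<Rightarrow> ('a \<Rightarrow> 'a) \<Rightarrow> bool" where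
  "affine_open R S \<phi> \<longleftrightarrow> cring S \<and> \<phi> \<in> ring_hom R S \<and>
     embedding_map (zariski S) (zariski R) (contraction R \<phi>) \<and>
     openin (zariski R) (contraction R \<phi> ` Spec S) \<and>
     (\<forall>q\<in>Spec S. stalk_map S \<phi> q \<in>
        ring_iso (loc_ring R (carrier R - contraction R \<phi> q)) (loc_ring S (carrier S - q)))"

section \<open>Base change of modules\<close>

text \<open>\<open>M \<otimes>\<^sub>R S\<close> is the free abelian group on \<open>M \<times> S\<close> modulo the subgroup
  generated by the bilinearity relations.\<close>

abbreviation tensor_free :: "'a ring \<Rightarrow> ('a, 'm) module \<Rightarrow> ('m \<times> 'a \<Rightarrow>\<^sub>0 int) monoid" where
  "tensor_free S M \<equiv> free_Abelian_group (carrier M \<times> carrier S)"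

definition tensor_rels ::
  "'a ring \<Rightarrow> 'a ring \<Rightarrow> ('a \<Rightarrow> 'a) \<Rightarrow> ('a, 'm) module \<Rightarrow> ('m \<times> 'a \<Rightarrow>\<^sub>0 int) set" where
  "tensor_rels R S \<phi> M = generate (tensor_free S M)
     ({frag_of (x \<oplus>\<^bsub>M\<^esub> y, s) - frag_of (x, s) - frag_of (y, s) | x y s.
         x \<in> carrier M \<and> y \<in> carrier M \<and> s \<in> carrier S} \<union>
      {frag_of (x, s \<oplus>\<^bsub>S\<^esub> t) - frag_of (x, s) - frag_of (x, t) | x s t.
         x \<in> carrier M \<and> s \<in> carrier S \<and> t \<in> carrier S} \<union>
      {frag_of (r \<odot>\<^bsub>M\<^esub> x, s) - frag_of (x, \<phi> r \<otimes>\<^bsub>S\<^esub> s) | r x s.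
         r \<in> carrier R \<and> x \<in> carrier M \<and> s \<in> carrier S})"

definition tensor_class ::
  "'a ring \<Rightarrow> 'a ring \<Rightarrow> ('a \<Rightarrow> 'a) \<Rightarrow> ('a, 'm) module \<Rightarrow> ('m \<times> 'a \<Rightarrow>\<^sub>0 int) \<Rightarrow>
     ('m \<times> 'a \<Rightarrow>\<^sub>0 int) set" where
  "tensor_class R S \<phi> M t = tensor_rels R S \<phi> M #>\<^bsub>tensor_free S M\<^esub> t"

definition base_change ::
  "'a ring \<Rightarrow> 'a ring \<Rightarrow> ('a \<Rightarrow> 'a) \<Rightarrow> ('a, 'm) module \<Rightarrow> ('a, ('m \<times> 'a \<Rightarrow>\<^sub>0 int) set) module" where
  "base_change R S \<phi> M = \<lparr>
     carrier = tensor_class R S \<phi> M ` carrier (tensor_free S M),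
     monoid.mult = undefined,
     monoid.one = undefined,
     ring.zero = tensor_rels R S \<phi> M,
     ring.add = (\<lambda>A B. A <#>\<^bsub>tensor_free S M\<^esub> B),
     module.smult = (\<lambda>s A. tensor_rels R S \<phi> M <#>\<^bsub>tensor_free S M\<^esub>
                      frag_extend (\<lambda>(x, t). frag_of (x, s \<otimes>\<^bsub>S\<^esub> t)) ` A)\<rparr>"

text \<open>The image of \<open>L \<otimes>\<^sub>R S \<rightarrow> M \<otimes>\<^sub>R S\<close>.\<close>

definition base_change_image ::
  "'a ring \<Rightarrow> 'a ring \<Rightarrow> ('a \<Rightarrow> 'a) \<Rightarrow> ('a, 'm) module \<Rightarrow> 'm set \<Rightarrow>
     ('m \<times> 'a \<Rightarrow>\<^sub>0 int) set set" where
  "base_change_image R S \<phi> M L =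
     tensor_class R S \<phi> M ` carrier (free_Abelian_group (L \<times> carrier S))"

section \<open>Preclosure operations over a spectrum\<close>

text \<open>The rings \<open>S\<close> of affine opens have their elements in the type \<open>'a\<close> of elements of \<open>R\<close>, and the
  modules under consideration have their elements in an arbitrary type \<open>'m\<close>. This loses nothing
  up to isomorphism: for an affine open \<open>Spec S\<close> of \<open>Spec R\<close> (in particular for \<open>S = R\<^sub>f\<close>),
  the cardinality of \<open>M \<otimes>\<^sub>R S\<close> is at most that of \<open>M\<close>. If \<open>M\<close> is infinite, this holds as
  \<open>M \<otimes>\<^sub>R S\<close> embeds into a finite product of localizations of \<open>M\<close> at single elements; if \<open>M\<close> is
  finite, \<open>R\<close> acts through a finite ring, over which \<open>M \<otimes>\<^sub>R S\<close> is a direct summand of \<open>M\<close>.\<close>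

type_synonym ('a, 'm) submodule_op =
  "'a ring \<Rightarrow> ('a \<Rightarrow> 'a) \<Rightarrow> ('a, 'm) module \<Rightarrow> 'm set \<Rightarrow> 'm set"

type_synonym 'a ideal_op = "'a ring \<Rightarrow> ('a \<Rightarrow> 'a) \<Rightarrow> 'a set \<Rightarrow> 'a set"

definition semilinear_iso ::
  "'s ring \<Rightarrow> ('s \<Rightarrow> 't) \<Rightarrow> ('s, 'm) module \<Rightarrow> ('t, 'n) module \<Rightarrow> ('m \<Rightarrow> 'n) \<Rightarrow> bool" where
  "semilinear_iso S \<sigma> M N h \<longleftrightarrow> bij_betw h (carrier M) (carrier N) \<and>
     (\<forall>x\<in>carrier M. \<forall>y\<in>carrier M. h (x \<oplus>\<^bsub>M\<^esub> y) = h x \<oplus>\<^bsub>N\<^esub> h y) \<and>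
     (\<forall>s\<in>carrier S. \<forall>x\<in>carrier M. h (s \<odot>\<^bsub>M\<^esub> x) = \<sigma> s \<odot>\<^bsub>N\<^esub> h x)"

text \<open>The operation is given on all affine opens \<open>(S, \<phi>)\<close> of \<open>Spec R\<close>; the value at \<open>Spec R\<close> itself
  is the one at \<open>(R, id)\<close>. The last clauses of the following two definitions express compatibility
  with isomorphisms, both of affine opens over \<open>R\<close> and of modules.\<close>

definition preclosure_on_submodules :: "'a ring \<Rightarrow> ('a, 'm) submodule_op \<Rightarrow> bool" where
  "preclosure_on_submodules R cl \<longleftrightarrow>
     (\<forall>S \<phi> M L. affine_open R S \<phi> \<and> module S M \<and> submodule L S M \<longrightarrow>
        submodule (cl S \<phi> M L) S M \<and> L \<subseteq> cl S \<phi> M L) \<and>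
     (\<forall>S \<phi> M L L'. affine_open R S \<phi> \<and> module S M \<and> submodule L S M \<and> submodule L' S M \<and>
        L \<subseteq> L' \<longrightarrow> cl S \<phi> M L \<subseteq> cl S \<phi> M L') \<and>
     (\<forall>S \<phi> M L S' \<phi>' M' \<sigma> h. affine_open R S \<phi> \<and> affine_open R S' \<phi>' \<and>
        module S M \<and> module S' M' \<and> submodule L S M \<and>
        \<sigma> \<in> ring_iso S S' \<and> (\<forall>r\<in>carrier R. \<sigma> (\<phi> r) = \<phi>' r) \<and> semilinear_iso S \<sigma> M M' h \<longrightarrow>
        cl S' \<phi>' M' (h ` L) = h ` cl S \<phi> M L)"

definition preclosure_on_ideals :: "'a ring \<Rightarrow> 'a ideal_op \<Rightarrow> bool" where
  "preclosure_on_ideals R cl \<longleftrightarrow>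
     (\<forall>S \<phi> I. affine_open R S \<phi> \<and> ideal I S \<longrightarrow> ideal (cl S \<phi> I) S \<and> I \<subseteq> cl S \<phi> I) \<and>
     (\<forall>S \<phi> I I'. affine_open R S \<phi> \<and> ideal I S \<and> ideal I' S \<and> I \<subseteq> I' \<longrightarrow>
        cl S \<phi> I \<subseteq> cl S \<phi> I') \<and>
     (\<forall>S \<phi> I S' \<phi>' \<sigma>. affine_open R S \<phi> \<and> affine_open R S' \<phi>' \<and> ideal I S \<and>
        \<sigma> \<in> ring_iso S S' \<and> (\<forall>r\<in>carrier R. \<sigma> (\<phi> r) = \<phi>' r) \<longrightarrow>
        cl S' \<phi>' (\<sigma> ` I) = \<sigma> ` cl S \<phi> I)"

text \<open>The values of the operation on a ring \<open>S\<close> and module \<open>M\<close> with elements in other types (such as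
  the localizations and tensor products constructed above) are obtained by transport along
  isomorphisms to a ring \<open>S'\<close> and module \<open>M'\<close> with elements in \<open>'a\<close> and \<open>'m\<close>; by compatibility with
  isomorphisms, the choice of the latter does not matter.\<close>

definition submod_closure ::
  "('a, 'm) submodule_op \<Rightarrow> 's ring \<Rightarrow> ('a \<Rightarrow> 's) \<Rightarrow> ('s, 'n) module \<Rightarrow> 'n set \<Rightarrow> 'n set" where
  "submod_closure cl S \<phi> M L = {y \<in> carrier M. \<exists>S' \<sigma> M' h.
     cring S' \<and> \<sigma> \<in> ring_iso S S' \<and> module S' M' \<and> semilinear_iso S \<sigma> M M' h \<and>
     h y \<in> cl S' (\<sigma> \<circ> \<phi>) M' (h ` L)}"

definition ideal_closure :: "'a ideal_op \<Rightarrow> 's ring \<Rightarrow> ('a \<Rightarrow> 's) \<Rightarrow> 's set \<Rightarrow> 's set" where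
  "ideal_closure cl S \<phi> J = {y \<in> carrier S. \<exists>S' \<sigma>.
     cring S' \<and> \<sigma> \<in> ring_iso S S' \<and> \<sigma> y \<in> cl S' (\<sigma> \<circ> \<phi>) (\<sigma> ` J)}"

text \<open>\<open>(L\<^sub>f)\<^sup>c\<^sup>l\<close> in \<open>M\<^sub>f\<close>, and \<open>(J\<^sub>f)\<^sup>c\<^sup>l\<close> in \<open>R\<^sub>f\<close>.\<close>

definition submod_closure_at ::
  "'a ring \<Rightarrow> ('a, 'm) submodule_op \<Rightarrow> 'a \<Rightarrow> ('a, 'm) module \<Rightarrow> 'm set \<Rightarrow> ('m \<times> 'a) set set" where
  "submod_closure_at R cl f M L =
     submod_closure cl (loc_ring R (powers R f)) (\<lambda>r. loc_frac R (powers R f) r \<one>\<^bsub>R\<^esub>)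
       (loc_mod R (powers R f) M) (loc_submod R (powers R f) M L)"

definition ideal_closure_at ::
  "'a ring \<Rightarrow> 'a ideal_op \<Rightarrow> 'a \<Rightarrow> 'a set \<Rightarrow> ('a \<times> 'a) set set" where
  "ideal_closure_at R cl f J =
     ideal_closure cl (loc_ring R (powers R f)) (\<lambda>r. loc_frac R (powers R f) r \<one>\<^bsub>R\<^esub>)
       (loc_ideal R (powers R f) J)"

definition openly_persistent_submodules :: "'a ring \<Rightarrow> ('a, 'm) submodule_op \<Rightarrow> bool" where
  "openly_persistent_submodules R cl \<longleftrightarrow>
     (\<forall>S \<phi> M L x. affine_open R S \<phi> \<and> module R M \<and> submodule L R M \<and> x \<in> cl R id M L \<longrightarrow>
        tensor_class R S \<phi> M (frag_of (x, \<one>\<^bsub>S\<^esub>)) \<in>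
          submod_closure cl S \<phi> (base_change R S \<phi> M) (base_change_image R S \<phi> M L))"

definition openly_persistent_ideals :: "'a ring \<Rightarrow> 'a ideal_op \<Rightarrow> bool" where
  "openly_persistent_ideals R cl \<longleftrightarrow>
     (\<forall>S \<phi> I x. affine_open R S \<phi> \<and> ideal I R \<and> x \<in> cl R id I \<longrightarrow>
        \<phi> x \<in> cl S \<phi> (genideal S (\<phi> ` I)))"

definition commutes_with_loc_submodules :: "'a ring \<Rightarrow> ('a, 'm) submodule_op \<Rightarrow> bool" where
  "commutes_with_loc_submodules R cl \<longleftrightarrow>
     (\<forall>f M L. f \<in> carrier R \<and> module R M \<and> submodule L R M \<longrightarrow>
        submod_closure_at R cl f M L = loc_submod R (powers R f) M (cl R id M L))"

definition commutes_with_loc_ideals :: "'a ring \<Rightarrow> 'a ideal_op \<Rightarrow> bool" where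
  "commutes_with_loc_ideals R cl \<longleftrightarrow>
     (\<forall>f I. f \<in> carrier R \<and> ideal I R \<longrightarrow>
        ideal_closure_at R cl f I = loc_ideal R (powers R f) (cl R id I))"

definition radical :: "'a ring \<Rightarrow> 'a set \<Rightarrow> 'a set" where
  "radical R I = {g \<in> carrier R. \<exists>n::nat. g [^]\<^bsub>R\<^esub> n \<in> I}"

text \<open>A generating family enters only through the set \<open>F\<close> of its members.\<close>

definition glueable_submodules :: "'a ring \<Rightarrow> ('a, 'm) submodule_op \<Rightarrow> bool" where
  "glueable_submodules R cl \<longleftrightarrow>
     (\<forall>I F g M L z. ideal I R \<and> F \<subseteq> carrier R \<and> I = genideal R F \<and> g \<in> radical R I \<and>
        module R M \<and> submodule L R M \<and> z \<in> carrier M \<and>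
        (\<forall>f\<in>F. mod_frac R (powers R f) M z \<one>\<^bsub>R\<^esub> \<in> submod_closure_at R cl f M L) \<longrightarrow>
        mod_frac R (powers R g) M z \<one>\<^bsub>R\<^esub> \<in> submod_closure_at R cl g M L)"

definition glueable_ideals :: "'a ring \<Rightarrow> 'a ideal_op \<Rightarrow> bool" where
  "glueable_ideals R cl \<longleftrightarrow>
     (\<forall>I F g J z. ideal I R \<and> F \<subseteq> carrier R \<and> I = genideal R F \<and> g \<in> radical R I \<and>
        ideal J R \<and> z \<in> carrier R \<and>
        (\<forall>f\<in>F. loc_frac R (powers R f) z \<one>\<^bsub>R\<^esub> \<in> ideal_closure_at R cl f J) \<longrightarrow>
        loc_frac R (powers R g) z \<one>\<^bsub>R\<^esub> \<in> ideal_closure_at R cl g J)"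

end

theory Submission
  imports Defs
begin

text \<open>Since the operation commutes with localization, \<open>z/1\<close> lies in the closure of \<open>L\<^sub>f\<close> exactly when
  it lies in \<open>N\<^sub>f\<close>, where \<open>N\<close> is the closure of \<open>L\<close> in \<open>M\<close> over \<open>R\<close> itself. This means that some
  power of \<open>f\<close> multiplies \<open>z\<close> into \<open>N\<close>, that is, \<open>f\<close> lies in the radical of the ideal
  \<open>(N : z)\<close> (lemma \<open>fraction_in_loc_submod_powers_iff\<close>). A radical ideal that contains the generators
  of \<open>I\<close> contains \<open>I\<close> and hence its radical; so \<open>g\<close> lies in it, too
  (lemma \<open>loc_submod_glueable\<close>). An ideal \<open>J\<close> is treated as a submodule of the
  module \<open>R\<close>, which does not change its localizations \<open>J\<^sub>f\<close>.

  For \<open>N\<close> to be a submodule, the operation has to be defined on \<open>R\<close>, so what remains is that the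
  identity of \<open>R\<close> is an affine open of \<open>Spec R\<close> in the sense of open immersions
  (lemma \<open>affine_open_id\<close>). This rests on two facts: the sets called open do form a
  topology, and the local rings are closed under their operations.\<close>

section \<open>Fractions\<close>

text \<open>Localizations and spectra are defined for rings and modules without additional record
  fields. These locales fix the types of \<open>R\<close> and \<open>M\<close> accordingly.\<close>

locale base_ring = cring R for R :: "'a ring" (structure)

locale base_module = module R M for R :: "'a ring" (structure) and M :: "('a, 'm) module" (structure)

sublocale base_module \<subseteq> R?: base_ring R ..

lemma (in base_ring) submonoid_powers:
  assumes "f \<in> carrier R"
  shows "submonoid (powers R f) R"
proof
  show "powers R f \<subseteq> carrier R"
    using assms by (auto simp: powers_def)
  show "x \<otimes> y \<in> powers R f" if "x \<in> powers R f" "y \<in> powers R f" for x y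
    using that assms by (auto simp: powers_def nat_pow_mult)
  show "\<one> \<in> powers R f"
    unfolding powers_def using nat_pow_0[of f, symmetric] by blast
qed

text \<open>This is the transitivity of the relation that defines fractions: if \<open>u\<close> identifies \<open>x/s\<close> with
  \<open>x'/s'\<close> and \<open>v\<close> identifies \<open>x/s\<close> with \<open>y/t\<close>, then \<open>v u s\<close> identifies \<open>x'/s'\<close> with \<open>y/t\<close>.\<close>

lemma (in base_module) mod_frac_subset:
  assumes W: "submonoid W R"
    and x: "x \<in> carrier M" "x' \<in> carrier M"
    and s: "s \<in> W" "s' \<in> W" "u \<in> W"
    and eq: "u \<odot>\<^bsub>M\<^esub> (s' \<odot>\<^bsub>M\<^esub> x) = u \<odot>\<^bsub>M\<^esub> (s \<odot>\<^bsub>M\<^esub> x')"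
  shows "mod_frac R W M x s \<subseteq> mod_frac R W M x' s'"
proof
  interpret W: submonoid W R by (rule W)
  fix p assume "p \<in> mod_frac R W M x s"
  then obtain y t v where p: "p = (y, t)" and y: "y \<in> carrier M" and t: "t \<in> W" and v: "v \<in> W"
    and eq': "v \<odot>\<^bsub>M\<^esub> (t \<odot>\<^bsub>M\<^esub> x) = v \<odot>\<^bsub>M\<^esub> (s \<odot>\<^bsub>M\<^esub> y)"
    by (auto simp: mod_frac_def)
  note R = s[THEN W.mem_carrier] t[THEN W.mem_carrier] v[THEN W.mem_carrier]
  have eq1: "(u \<otimes> s') \<odot>\<^bsub>M\<^esub> x = (u \<otimes> s) \<odot>\<^bsub>M\<^esub> x'"
    using eq R x by (simp add: smult_assoc1)
  have eq2: "(v \<otimes> t) \<odot>\<^bsub>M\<^esub> x = (v \<otimes> s) \<odot>\<^bsub>M\<^esub> y"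
    using eq' R x y by (simp add: smult_assoc1)
  have "(v \<otimes> u \<otimes> s) \<odot>\<^bsub>M\<^esub> (t \<odot>\<^bsub>M\<^esub> x') = (v \<otimes> t) \<odot>\<^bsub>M\<^esub> ((u \<otimes> s) \<odot>\<^bsub>M\<^esub> x')"
    using R x by (simp add: smult_assoc1[symmetric] m_ac)
  also have "\<dots> = (u \<otimes> s') \<odot>\<^bsub>M\<^esub> ((v \<otimes> t) \<odot>\<^bsub>M\<^esub> x)"
    using R x by (simp add: eq1[symmetric]) (simp add: smult_assoc1[symmetric] m_ac)
  also have "\<dots> = (v \<otimes> u \<otimes> s) \<odot>\<^bsub>M\<^esub> (s' \<odot>\<^bsub>M\<^esub> y)"
    using R y by (simp add: eq2) (simp add: smult_assoc1[symmetric] m_ac)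
  finally show "p \<in> mod_frac R W M x' s'"
    unfolding mod_frac_def p using y t v s by blast
qed

lemma (in base_module) mod_frac_eqI:
  assumes "submonoid W R" "x \<in> carrier M" "x' \<in> carrier M" "s \<in> W" "s' \<in> W" "u \<in> W"
    and "u \<odot>\<^bsub>M\<^esub> (s' \<odot>\<^bsub>M\<^esub> x) = u \<odot>\<^bsub>M\<^esub> (s \<odot>\<^bsub>M\<^esub> x')"
  shows "mod_frac R W M x s = mod_frac R W M x' s'"
  using mod_frac_subset[of W x x' s s' u] mod_frac_subset[of W x' x s' s u] assms by auto

lemma (in base_module) mod_frac_self:
  assumes "submonoid W R" "x \<in> carrier M" "s \<in> W"
  shows "(x, s) \<in> mod_frac R W M x s"
  using assms submonoid.one_closed[OF assms(1)] by (auto simp: mod_frac_def)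

text \<open>If \<open>z/1 = x/s\<close> with \<open>x\<close> in \<open>N\<close>, then \<open>u s z = u x\<close> lies in \<open>N\<close> for some \<open>u\<close> in \<open>W\<close>;
  conversely, \<open>z/1 = (u z)/u\<close>.\<close>

lemma (in base_module) fraction_in_loc_submod_iff:
  assumes W: "submonoid W R" and N: "submodule N R M" and z: "z \<in> carrier M"
  shows "mod_frac R W M z \<one> \<in> loc_submod R W M N \<longleftrightarrow> (\<exists>u\<in>W. u \<odot>\<^bsub>M\<^esub> z \<in> N)"
proof -
  interpret W: submonoid W R by (rule W)
  note N_sub = submoduleE(1)[OF N]
  show ?thesis
  proof
    assume "mod_frac R W M z \<one> \<in> loc_submod R W M N"
    then obtain x s where x: "x \<in> N" and s: "s \<in> W"
      and eq: "mod_frac R W M z \<one> = mod_frac R W M x s"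
      unfolding loc_submod_def by blast
    have xM: "x \<in> carrier M"
      using x N_sub by blast
    have "(x, s) \<in> mod_frac R W M z \<one>"
      unfolding eq by (rule mod_frac_self[OF W xM s])
    then obtain u where u: "u \<in> W" and "u \<odot>\<^bsub>M\<^esub> (s \<odot>\<^bsub>M\<^esub> z) = u \<odot>\<^bsub>M\<^esub> (\<one> \<odot>\<^bsub>M\<^esub> x)"
      unfolding mod_frac_def by blast
    hence "(u \<otimes> s) \<odot>\<^bsub>M\<^esub> z = u \<odot>\<^bsub>M\<^esub> x"
      using z s xM by (simp add: smult_assoc1)
    also have "u \<odot>\<^bsub>M\<^esub> x \<in> N"
      using submoduleE(4)[OF N] u x by simp
    finally show "\<exists>u\<in>W. u \<odot>\<^bsub>M\<^esub> z \<in> N"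
      using W.m_closed[OF u s] by blast
  next
    assume "\<exists>u\<in>W. u \<odot>\<^bsub>M\<^esub> z \<in> N"
    then obtain u where u: "u \<in> W" "u \<odot>\<^bsub>M\<^esub> z \<in> N" by blast
    have "mod_frac R W M z \<one> = mod_frac R W M (u \<odot>\<^bsub>M\<^esub> z) u"
      by (rule mod_frac_eqI[OF W, where u = \<one>]) (use u z in simp_all)
    thus "mod_frac R W M z \<one> \<in> loc_submod R W M N"
      unfolding loc_submod_def using u by blast
  qed
qed

section \<open>Radicals and conductors\<close>

text \<open>The usual proof expands \<open>(a + b)\<^sup>m\<^sup>+\<^sup>n\<close>. The induction on \<open>m + n\<close> that underlies the
  expansion becomes direct with a factor \<open>c\<close>: one factor \<open>a + b\<close> is split off, and its summands
  \<open>a\<close> and \<open>b\<close> are moved into \<open>c\<close>, which lowers \<open>m\<close> or \<open>n\<close>.\<close>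

lemma (in base_ring) add_pow_mult_mem_ideal:
  assumes "ideal C R" and ab: "a \<in> carrier R" "b \<in> carrier R" and "c \<in> carrier R"
    and "a [^] (m::nat) \<otimes> c \<in> C" "b [^] (n::nat) \<otimes> c \<in> C"
  shows "(a \<oplus> b) [^] (m + n) \<otimes> c \<in> C"
proof -
  interpret ideal C R by fact
  show ?thesis
    using assms(4-)
  proof (induction "m + n" arbitrary: m n c)
    case 0
    thus ?case by simp
  next
    case (Suc k)
    show ?case
    proof (cases "m = 0 \<or> n = 0")
      case True
      hence "c \<in> C" using Suc.prems by auto
      thus ?thesis using ab by (auto intro: I_l_closed)
    next
      case False
      then obtain m' n' where mn: "m = Suc m'" "n = Suc n'"
        by (metis not0_implies_Suc)
      have "(a \<oplus> b) [^] (m' + n) \<otimes> (a \<otimes> c) \<in> C"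
      proof (rule Suc.hyps(1))
        show "a [^] m' \<otimes> (a \<otimes> c) \<in> C"
          using Suc.prems ab mn by (simp add: m_assoc)
        have "b [^] n \<otimes> (a \<otimes> c) = a \<otimes> (b [^] n \<otimes> c)"
          using Suc.prems(1) ab by (simp add: m_lcomm)
        thus "b [^] n \<otimes> (a \<otimes> c) \<in> C"
          using Suc.prems ab I_l_closed by simp
      qed (use Suc.hyps(2) Suc.prems ab mn in auto)
      moreover have "(a \<oplus> b) [^] (m + n') \<otimes> (b \<otimes> c) \<in> C"
      proof (rule Suc.hyps(1))
        show "b [^] n' \<otimes> (b \<otimes> c) \<in> C"
          using Suc.prems ab mn by (simp add: m_assoc)
        have "a [^] m \<otimes> (b \<otimes> c) = b \<otimes> (a [^] m \<otimes> c)"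
          using Suc.prems(1) ab by (simp add: m_lcomm)
        thus "a [^] m \<otimes> (b \<otimes> c) \<in> C"
          using Suc.prems ab I_l_closed by simp
      qed (use Suc.hyps(2) Suc.prems ab mn in auto)
      ultimately have "(a \<oplus> b) [^] k \<otimes> (a \<otimes> c) \<oplus> (a \<oplus> b) [^] k \<otimes> (b \<otimes> c) \<in> C"
        using Suc.hyps(2) mn by simp
      moreover have "(a \<oplus> b) [^] (m + n) \<otimes> c
          = (a \<oplus> b) [^] k \<otimes> (a \<otimes> c) \<oplus> (a \<oplus> b) [^] k \<otimes> (b \<otimes> c)"
        unfolding Suc.hyps(2)[symmetric] using Suc.prems(1) ab
        by (simp add: m_assoc l_distr r_distr)
      ultimately show ?thesis by simp
    qed
  qed
qed

lemma (in base_ring) radical_ideal: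
  assumes "ideal C R"
  shows "ideal (radical R C) R"
proof -
  interpret ideal C R by fact
  have mult: "r \<otimes> a \<in> radical R C" if "r \<in> carrier R" "a \<in> radical R C" for r a
    using that by (auto simp: radical_def nat_pow_distrib intro: I_l_closed)
  show ?thesis
  proof (rule idealI)
    show "subgroup (radical R C) (add_monoid R)"
    proof (rule add.subgroupI)
      show "radical R C \<subseteq> carrier R"
        by (auto simp: radical_def)
      have "\<zero> [^] (1::nat) \<in> C" by simp
      hence "\<zero> \<in> radical R C"
        unfolding radical_def by blast
      thus "radical R C \<noteq> {}" by blast
      show "\<ominus> a \<in> radical R C" if "a \<in> radical R C" for a
        using mult[of "\<ominus> \<one>" a] that by (simp add: radical_def l_minus)
      show "a \<oplus> b \<in> radical R C" if "a \<in> radical R C" "b \<in> radical R C" for a b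
        using that add_pow_mult_mem_ideal[OF assms, of a b \<one>] by (fastforce simp: radical_def)
    qed
    show "a \<otimes> r \<in> radical R C" if "a \<in> radical R C" "r \<in> carrier R" for a r
      using mult[OF that(2,1)] that by (simp add: radical_def m_comm)
  qed (use mult ring_axioms in auto)
qed

lemma (in base_ring) radical_mono: "I \<subseteq> J \<Longrightarrow> radical R I \<subseteq> radical R J"
  by (auto simp: radical_def)

lemma (in base_ring) radical_radical_subset: "radical R (radical R C) \<subseteq> radical R C"
  by (auto simp: radical_def nat_pow_pow)

text \<open>The colon ideal \<open>(N : z)\<close>.\<close>

definition conductor :: "('a, 'b) ring_scheme \<Rightarrow> ('a, 'm, 'c) module_scheme \<Rightarrow> 'm set \<Rightarrow> 'm \<Rightarrow> 'a set"
  where "conductor R M N z = {r \<in> carrier R. r \<odot>\<^bsub>M\<^esub> z \<in> N}"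

lemma (in base_module) conductor_ideal:
  assumes N: "submodule N R M" and z: "z \<in> carrier M"
  shows "ideal (conductor R M N z) R"
proof (rule idealI)
  note submod = submoduleE[OF N]
  show "subgroup (conductor R M N z) (add_monoid R)"
  proof (rule R.add.subgroupI)
    have "\<zero>\<^bsub>M\<^esub> \<in> N"
      using N subgroup.one_closed submodule.axioms(1) by fastforce
    thus "conductor R M N z \<noteq> {}"
      using z smult_l_null by (auto simp: conductor_def)
  qed (use z submod in \<open>auto simp: conductor_def smult_l_minus smult_l_distr\<close>)
  show mult: "r \<otimes> a \<in> conductor R M N z" if "a \<in> conductor R M N z" "r \<in> carrier R" for a r
    using that z submod(4) by (auto simp: conductor_def smult_assoc1)
  show "a \<otimes> r \<in> conductor R M N z" if "a \<in> conductor R M N z" "r \<in> carrier R" for a r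
    using mult[OF that] that by (simp add: conductor_def m_comm)
qed (rule R.ring_axioms)

lemma (in base_module) fraction_in_loc_submod_powers_iff:
  assumes "submodule N R M" "z \<in> carrier M" and f: "f \<in> carrier R"
  shows "mod_frac R (powers R f) M z \<one> \<in> loc_submod R (powers R f) M N
    \<longleftrightarrow> f \<in> radical R (conductor R M N z)"
  unfolding fraction_in_loc_submod_iff[OF R.submonoid_powers[OF f] assms(1,2)]
  using f by (auto simp: powers_def radical_def conductor_def)

lemma (in base_module) loc_submod_glueable:
  assumes N: "submodule N R M" and z: "z \<in> carrier M"
    and F: "F \<subseteq> carrier R" and g: "g \<in> radical R (genideal R F)"
    and loc: "\<And>f. f \<in> F \<Longrightarrow> mod_frac R (powers R f) M z \<one> \<in> loc_submod R (powers R f) M N"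
  shows "mod_frac R (powers R g) M z \<one> \<in> loc_submod R (powers R g) M N"
proof -
  let ?C = "conductor R M N z"
  have "F \<subseteq> radical R ?C"
    using loc F fraction_in_loc_submod_powers_iff[OF N z] by auto
  hence "genideal R F \<subseteq> radical R ?C"
    by (intro R.genideal_minimal R.radical_ideal conductor_ideal N z)
  hence "g \<in> radical R ?C"
    using g R.radical_mono R.radical_radical_subset by blast
  thus ?thesis
    using fraction_in_loc_submod_powers_iff[OF N z] g by (simp add: radical_def)
qed

section \<open>The ring as a module over itself\<close>

definition self_module :: "'a ring \<Rightarrow> ('a, 'a) module" where
  "self_module R = \<lparr>carrier = carrier R, monoid.mult = monoid.mult R, monoid.one = \<one>\<^bsub>R\<^esub>,
     ring.zero = \<zero>\<^bsub>R\<^esub>, ring.add = ring.add R, module.smult = monoid.mult R\<rparr>"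

lemma (in base_ring) module_self_module: "base_module R (self_module R)"
  unfolding base_module_def
proof (rule moduleI)
  show "abelian_group (self_module R)"
    by (rule abelian_groupI) (auto simp: self_module_def a_ac intro: l_neg)
qed (auto simp: self_module_def l_distr r_distr m_assoc is_cring)

lemma (in base_ring) ideal_imp_submodule_self_module:
  assumes "ideal J R"
  shows "submodule J R (self_module R)"
proof -
  interpret J: ideal J R by fact
  have "subgroup J (add_monoid (self_module R))"
    using J.a_subgroup by (simp add: self_module_def subgroup_def m_inv_def)
  thus ?thesis
    unfolding submodule_def submodule_axioms_def
    by (auto simp: self_module_def J.I_l_closed)
qed

lemma mod_frac_self_module: "mod_frac R W (self_module R) = loc_frac R W"
  by (intro ext) (simp add: mod_frac_def loc_frac_def self_module_def)

lemma loc_submod_self_module: "loc_submod R W (self_module R) = loc_ideal R W"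
  by (intro ext) (simp add: loc_submod_def loc_ideal_def mod_frac_self_module)

section \<open>The whole spectrum as an affine open\<close>

lemma (in base_ring) loc_frac_eqI:
  assumes "submonoid W R" "r \<in> carrier R" "r' \<in> carrier R" "s \<in> W" "s' \<in> W" "u \<in> W"
    and "u \<otimes> (s' \<otimes> r) = u \<otimes> (s \<otimes> r')"
  shows "loc_frac R W r s = loc_frac R W r' s'"
  using base_module.mod_frac_eqI[OF module_self_module, of W r r' s s' u] assms
  by (simp add: mod_frac_self_module) (simp add: self_module_def)

lemma (in base_ring) loc_frac_self:
  assumes "submonoid W R" "r \<in> carrier R" "s \<in> W"
  shows "(r, s) \<in> loc_frac R W r s"
  using base_module.mod_frac_self[OF module_self_module, of W r s] assms
  by (simp add: mod_frac_self_module) (simp add: self_module_def)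

text \<open>The sum and the product of fractions are unions over all representatives, of sets that do
  not depend on the representatives.\<close>

lemma UN_constant_value:
  assumes "p \<in> A" "\<And>q. q \<in> A \<Longrightarrow> h q = c"
  shows "(\<Union>q\<in>A. h q) = c"
  using assms by auto

lemma (in base_ring) loc_frac_mult:
  assumes W: "submonoid W R" and r: "r \<in> carrier R" "r' \<in> carrier R" and s: "s \<in> W" "s' \<in> W"
  shows "loc_frac R W r s \<otimes>\<^bsub>loc_ring R W\<^esub> loc_frac R W r' s' = loc_frac R W (r \<otimes> r') (s \<otimes> s')"
proof -
  interpret W: submonoid W R by (rule W)
  have eq: "loc_frac R W (a \<otimes> a') (b \<otimes> b') = loc_frac R W (r \<otimes> r') (s \<otimes> s')"
    if ab: "(a, b) \<in> loc_frac R W r s" "(a', b') \<in> loc_frac R W r' s'" for a b a' b'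
  proof -
    obtain u where u: "u \<in> W" "a \<in> carrier R" "b \<in> W" "u \<otimes> (b \<otimes> r) = u \<otimes> (s \<otimes> a)"
      using ab(1) by (auto simp: loc_frac_def)
    obtain u' where u': "u' \<in> W" "a' \<in> carrier R" "b' \<in> W" "u' \<otimes> (b' \<otimes> r') = u' \<otimes> (s' \<otimes> a')"
      using ab(2) by (auto simp: loc_frac_def)
    have "(u \<otimes> u') \<otimes> ((s \<otimes> s') \<otimes> (a \<otimes> a')) = (u \<otimes> (s \<otimes> a)) \<otimes> (u' \<otimes> (s' \<otimes> a'))"
      using u(1-3) u'(1-3) r s by (simp add: m_ac)
    also have "\<dots> = (u \<otimes> (b \<otimes> r)) \<otimes> (u' \<otimes> (b' \<otimes> r'))"
      by (simp only: u(4) u'(4))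
    also have "\<dots> = (u \<otimes> u') \<otimes> ((b \<otimes> b') \<otimes> (r \<otimes> r'))"
      using u(1-3) u'(1-3) r s by (simp add: m_ac)
    finally show ?thesis
      by (intro loc_frac_eqI[OF W, where u = "u \<otimes> u'"]) (use u(1-3) u'(1-3) r s in auto)
  qed
  show ?thesis
    unfolding loc_ring_def
    by (simp, intro UN_constant_value[OF loc_frac_self[OF W r(1) s(1)]], clarsimp,
        intro UN_constant_value[OF loc_frac_self[OF W r(2) s(2)]], clarsimp simp: eq)
qed

lemma (in base_ring) loc_frac_add:
  assumes W: "submonoid W R" and r: "r \<in> carrier R" "r' \<in> carrier R" and s: "s \<in> W" "s' \<in> W"
  shows "loc_frac R W r s \<oplus>\<^bsub>loc_ring R W\<^esub> loc_frac R W r' s'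
    = loc_frac R W (s' \<otimes> r \<oplus> s \<otimes> r') (s \<otimes> s')"
proof -
  interpret W: submonoid W R by (rule W)
  have eq: "loc_frac R W (b' \<otimes> a \<oplus> b \<otimes> a') (b \<otimes> b') = loc_frac R W (s' \<otimes> r \<oplus> s \<otimes> r') (s \<otimes> s')"
    if ab: "(a, b) \<in> loc_frac R W r s" "(a', b') \<in> loc_frac R W r' s'" for a b a' b'
  proof -
    obtain u where u: "u \<in> W" "a \<in> carrier R" "b \<in> W" "u \<otimes> (b \<otimes> r) = u \<otimes> (s \<otimes> a)"
      using ab(1) by (auto simp: loc_frac_def)
    obtain u' where u': "u' \<in> W" "a' \<in> carrier R" "b' \<in> W" "u' \<otimes> (b' \<otimes> r') = u' \<otimes> (s' \<otimes> a')"
      using ab(2) by (auto simp: loc_frac_def)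
    have "(u \<otimes> u') \<otimes> ((s \<otimes> s') \<otimes> (b' \<otimes> a \<oplus> b \<otimes> a'))
        = (u' \<otimes> (s' \<otimes> b')) \<otimes> (u \<otimes> (s \<otimes> a)) \<oplus> (u \<otimes> (s \<otimes> b)) \<otimes> (u' \<otimes> (s' \<otimes> a'))"
      using u(1-3) u'(1-3) r s by (simp add: m_ac r_distr)
    also have "\<dots> = (u' \<otimes> (s' \<otimes> b')) \<otimes> (u \<otimes> (b \<otimes> r)) \<oplus> (u \<otimes> (s \<otimes> b)) \<otimes> (u' \<otimes> (b' \<otimes> r'))"
      by (simp only: u(4) u'(4))
    also have "\<dots> = (u \<otimes> u') \<otimes> ((b \<otimes> b') \<otimes> (s' \<otimes> r \<oplus> s \<otimes> r'))"
      using u(1-3) u'(1-3) r s by (simp add: m_ac r_distr)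
    finally show ?thesis
      by (intro loc_frac_eqI[OF W, where u = "u \<otimes> u'"]) (use u(1-3) u'(1-3) r s in auto)
  qed
  show ?thesis
    unfolding loc_ring_def
    by (simp, intro UN_constant_value[OF loc_frac_self[OF W r(1) s(1)]], clarsimp,
        intro UN_constant_value[OF loc_frac_self[OF W r(2) s(2)]], clarsimp simp: eq)
qed

lemma loc_ring_carrier:
  "carrier (loc_ring R W) = {loc_frac R W r s | r s. r \<in> carrier R \<and> s \<in> W}"
  by (simp add: loc_ring_def)

text \<open>The stalk map of the identity of \<open>R\<close> is the identity only on fractions, not on arbitrary sets
  of pairs. Transferring the operations along such a map takes the closure of the fractions
  under them.\<close>

lemma (in base_ring) ring_iso_loc_ring_if_id_on:
  assumes W: "submonoid W R" and h: "\<And>A. A \<in> carrier (loc_ring R W) \<Longrightarrow> h A = A"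
  shows "h \<in> ring_iso (loc_ring R W) (loc_ring R W)"
proof -
  interpret W: submonoid W R by (rule W)
  let ?Q = "loc_ring R W"
  have mult: "A \<otimes>\<^bsub>?Q\<^esub> B \<in> carrier ?Q" if "A \<in> carrier ?Q" "B \<in> carrier ?Q" for A B
    using that loc_frac_mult[OF W] unfolding loc_ring_carrier by fastforce
  have add: "A \<oplus>\<^bsub>?Q\<^esub> B \<in> carrier ?Q" if AB: "A \<in> carrier ?Q" "B \<in> carrier ?Q" for A B
  proof -
    obtain r s r' s' where "A = loc_frac R W r s" "B = loc_frac R W r' s'"
      and *: "r \<in> carrier R" "s \<in> W" "r' \<in> carrier R" "s' \<in> W"
      using AB unfolding loc_ring_carrier by blast
    moreover have "s' \<otimes> r \<oplus> s \<otimes> r' \<in> carrier R" "s \<otimes> s' \<in> W"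
      using * by auto
    ultimately show ?thesis
      unfolding loc_ring_carrier mem_Collect_eq
      by (intro exI[of _ "s' \<otimes> r \<oplus> s \<otimes> r'"] exI[of _ "s \<otimes> s'"]) (simp add: loc_frac_add[OF W])
  qed
  have one: "\<one>\<^bsub>?Q\<^esub> \<in> carrier ?Q"
  proof -
    have "\<one>\<^bsub>?Q\<^esub> = loc_frac R W \<one> \<one>"
      by (simp add: loc_ring_def)
    thus ?thesis
      unfolding loc_ring_carrier using W.one_closed one_closed by blast
  qed
  have "h \<in> ring_hom ?Q ?Q"
    by (rule ring_hom_memI) (simp_all add: h mult add one)
  moreover have "bij_betw h (carrier ?Q) (carrier ?Q)"
    by (simp add: bij_betw_def inj_on_def h cong: image_cong)
  ultimately show ?thesis by (simp add: ring_iso_def)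
qed

lemma (in primeideal) submonoid_complement: "submonoid (carrier R - I) R"
proof
  show "x \<otimes> y \<in> carrier R - I" if "x \<in> carrier R - I" "y \<in> carrier R - I" for x y
    using that I_prime by auto
  show "\<one> \<in> carrier R - I"
    using one_imp_carrier I_notcarr by auto
qed auto

text \<open>With \<open>V(E)\<close> for the set of primes that contain \<open>E\<close>, the set \<open>V(E) \<union> V(E')\<close> is \<open>V\<close> of the
  products of elements of \<open>E\<close> and \<open>E'\<close>.\<close>

lemma (in base_ring) istopology_zariski: "istopology (zariski_open R)"
  unfolding istopology_def
proof (intro conjI allI impI)
  fix U V assume "zariski_open R U" "zariski_open R V"
  then obtain E E' where E: "E \<subseteq> carrier R" "U = {p \<in> Spec R. \<not> E \<subseteq> p}"
    and E': "E' \<subseteq> carrier R" "V = {p \<in> Spec R. \<not> E' \<subseteq> p}"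
    by (auto simp: zariski_open_def)
  define P where "P = {a \<otimes> b | a b. a \<in> E \<and> b \<in> E'}"
  have "P \<subseteq> p \<longleftrightarrow> E \<subseteq> p \<or> E' \<subseteq> p" if "p \<in> Spec R" for p
  proof -
    interpret p: primeideal p R using that by (simp add: Spec_def)
    show ?thesis
    proof
      assume P: "P \<subseteq> p"
      have "E' \<subseteq> p" if a: "a \<in> E" "a \<notin> p" for a
      proof
        fix b assume b: "b \<in> E'"
        hence "a \<otimes> b \<in> p" using P a by (auto simp: P_def)
        thus "b \<in> p" using p.I_prime a b E E' by blast
      qed
      thus "E \<subseteq> p \<or> E' \<subseteq> p" by blast
    next
      assume "E \<subseteq> p \<or> E' \<subseteq> p"
      thus "P \<subseteq> p"
        using E(1) E'(1) p.I_l_closed p.I_r_closed by (auto simp: P_def subset_iff)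
    qed
  qed
  hence "U \<inter> V = {p \<in> Spec R. \<not> P \<subseteq> p}"
    using E E' by auto
  moreover have "P \<subseteq> carrier R"
    using E(1) E'(1) by (auto simp: P_def)
  ultimately show "zariski_open R (U \<inter> V)"
    by (auto simp: zariski_open_def)
next
  fix \<U> assume "\<forall>U\<in>\<U>. zariski_open R U"
  then obtain E where E: "\<And>U. U \<in> \<U> \<Longrightarrow> E U \<subseteq> carrier R \<and> U = {p \<in> Spec R. \<not> E U \<subseteq> p}"
    unfolding zariski_open_def by metis
  have "\<Union>\<U> = {p \<in> Spec R. \<not> (\<Union>U\<in>\<U>. E U) \<subseteq> p}"
    using E by blast
  moreover have "(\<Union>U\<in>\<U>. E U) \<subseteq> carrier R"
    using E by blast
  ultimately show "zariski_open R (\<Union>\<U>)"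
    by (auto simp: zariski_open_def)
qed

lemma (in base_ring) openin_zariski_Spec: "openin (zariski R) (Spec R)"
proof -
  have "Spec R = {p \<in> Spec R. \<not> {\<one>} \<subseteq> p}"
    using primeideal.submonoid_complement submonoid.one_closed by (fastforce simp: Spec_def)
  hence "zariski_open R (Spec R)"
    unfolding zariski_open_def by (intro exI[of _ "{\<one>}"]) auto
  thus ?thesis
    by (simp add: zariski_def istopology_zariski)
qed

lemma (in base_ring) topspace_zariski: "topspace (zariski R) = Spec R"
proof
  have "openin (zariski R) (topspace (zariski R))" by simp
  thus "topspace (zariski R) \<subseteq> Spec R"
    by (auto simp: zariski_def istopology_zariski zariski_open_def)
  show "Spec R \<subseteq> topspace (zariski R)"
    using openin_subset[OF openin_zariski_Spec] .
qed

text \<open>Contraction along the identity fixes every prime, so it is the identity of the spectrum, and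
  the induced maps on stalks fix every fraction.\<close>

lemma (in base_ring) affine_open_id: "affine_open R R id"
  unfolding affine_open_def
proof (intro conjI ballI)
  show "cring R" by (rule is_cring)
  show "id \<in> ring_hom R R"
    by (rule ring_hom_memI) auto
  have contr: "contraction R id p = p" if p: "p \<in> Spec R" for p
  proof -
    interpret primeideal p R using p by (simp add: Spec_def)
    show ?thesis by (auto simp: contraction_def)
  qed
  have "embedding_map (zariski R) (zariski R) id"
    unfolding embedding_map_def image_id id_apply subtopology_topspace homeomorphic_map_id ..
  thus "embedding_map (zariski R) (zariski R) (contraction R id)"
    by (rule embedding_map_eq) (simp add: topspace_zariski contr)
  show "openin (zariski R) (contraction R id ` Spec R)"
    using openin_zariski_Spec by (simp add: contr cong: image_cong)
  fix p assume p: "p \<in> Spec R"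
  interpret p: primeideal p R using p by (simp add: Spec_def)
  note W = p.submonoid_complement
  let ?W = "carrier R - p"
  have "stalk_map R id p A = A" if "A \<in> carrier (loc_ring R ?W)" for A
  proof -
    obtain r s where A: "A = loc_frac R ?W r s" "r \<in> carrier R" "s \<in> ?W"
      using \<open>A \<in> _\<close> unfolding loc_ring_carrier by blast
    have eq: "loc_frac R ?W a b = A" if ab: "(a, b) \<in> A" for a b
    proof -
      obtain u where "a \<in> carrier R" "b \<in> ?W" "u \<in> ?W" "u \<otimes> (b \<otimes> r) = u \<otimes> (s \<otimes> a)"
        using ab unfolding A(1) loc_frac_def by blast
      thus ?thesis
        unfolding A(1) using loc_frac_eqI[OF W A(2) _ A(3), of a b u] by simp
    qed
    have "(r, s) \<in> A"
      unfolding A(1) by (rule loc_frac_self[OF W A(2,3)])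
    thus ?thesis
      unfolding stalk_map_def id_apply
      by (rule UN_constant_value) (use eq in \<open>simp add: split_beta\<close>)
  qed
  thus "stalk_map R id p \<in>
      ring_iso (loc_ring R (carrier R - contraction R id p)) (loc_ring R (carrier R - p))"
    unfolding contr[OF p] by (rule ring_iso_loc_ring_if_id_on[OF W])
qed

section \<open>Glueing\<close>

theorem proposition2p2:
  fixes R :: "'a ring"
    and cl :: "('a, 'm) submodule_op"
    and cl' :: "'a ideal_op"
  assumes "cring R"
  shows "(preclosure_on_submodules R cl \<and> openly_persistent_submodules R cl \<and>
            commutes_with_loc_submodules R cl \<longrightarrow> glueable_submodules R cl) \<and>
         (preclosure_on_ideals R cl' \<and> openly_persistent_ideals R cl' \<and>
            commutes_with_loc_ideals R cl' \<longrightarrow> glueable_ideals R cl')"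
proof (intro conjI impI; elim conjE)
  interpret base_ring R using assms by (rule base_ring.intro)
  assume pre: "preclosure_on_submodules R cl" and comm: "commutes_with_loc_submodules R cl"
  show "glueable_submodules R cl"
    unfolding glueable_submodules_def
  proof (intro allI impI, elim conjE)
    fix I F g M L z
    assume F: "F \<subseteq> carrier R" and I: "I = genideal R F" and g: "g \<in> radical R I"
      and M: "module R (M :: ('a, 'm) module)" and L: "submodule L R M" and z: "z \<in> carrier M"
      and loc: "\<forall>f\<in>F. mod_frac R (powers R f) M z \<one>\<^bsub>R\<^esub> \<in> submod_closure_at R cl f M L"
    interpret M: base_module R M using M by (rule base_module.intro)
    have N: "submodule (cl R id M L) R M"
      using pre affine_open_id M L by (auto simp: preclosure_on_submodules_def)
    have closure_at: "submod_closure_at R cl f M L = loc_submod R (powers R f) M (cl R id M L)"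
      if "f \<in> carrier R" for f
      using comm that M L by (simp add: commutes_with_loc_submodules_def)
    have "mod_frac R (powers R g) M z \<one>\<^bsub>R\<^esub> \<in> loc_submod R (powers R g) M (cl R id M L)"
    proof (rule M.loc_submod_glueable[OF N z F])
      show "g \<in> radical R (genideal R F)"
        using g I by simp
      show "mod_frac R (powers R f) M z \<one>\<^bsub>R\<^esub> \<in> loc_submod R (powers R f) M (cl R id M L)"
        if "f \<in> F" for f
        using bspec[OF loc that] closure_at[OF subsetD[OF F that]] by simp
    qed
    thus "mod_frac R (powers R g) M z \<one>\<^bsub>R\<^esub> \<in> submod_closure_at R cl g M L"
      using closure_at g by (simp add: radical_def)
  qed
next
  interpret base_ring R using assms by (rule base_ring.intro)
  assume pre: "preclosure_on_ideals R cl'" and comm: "commutes_with_loc_ideals R cl'"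
  show "glueable_ideals R cl'"
    unfolding glueable_ideals_def
  proof (intro allI impI, elim conjE)
    fix I F g J z
    assume F: "F \<subseteq> carrier R" and I: "I = genideal R F" and g: "g \<in> radical R I"
      and J: "ideal J R" and z: "z \<in> carrier R"
      and loc: "\<forall>f\<in>F. loc_frac R (powers R f) z \<one>\<^bsub>R\<^esub> \<in> ideal_closure_at R cl' f J"
    interpret M: base_module R "self_module R" by (rule module_self_module)
    have "ideal (cl' R id J) R"
      using pre affine_open_id J by (auto simp: preclosure_on_ideals_def)
    hence N: "submodule (cl' R id J) R (self_module R)"
      by (rule ideal_imp_submodule_self_module)
    have z': "z \<in> carrier (self_module R)"
      using z by (simp add: self_module_def)
    have closure_at: "ideal_closure_at R cl' f J = loc_ideal R (powers R f) (cl' R id J)"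
      if "f \<in> carrier R" for f
      using comm that J by (simp add: commutes_with_loc_ideals_def)
    have "loc_frac R (powers R g) z \<one>\<^bsub>R\<^esub> \<in> loc_ideal R (powers R g) (cl' R id J)"
    proof (rule M.loc_submod_glueable[OF N z' F, unfolded mod_frac_self_module loc_submod_self_module])
      show "g \<in> radical R (genideal R F)"
        using g I by simp
      show "loc_frac R (powers R f) z \<one>\<^bsub>R\<^esub> \<in> loc_ideal R (powers R f) (cl' R id J)"
        if "f \<in> F" for f
        using bspec[OF loc that] closure_at[OF subsetD[OF F that]] by simp
    qed
    thus "loc_frac R (powers R g) z \<one>\<^bsub>R\<^esub> \<in> ideal_closure_at R cl' g J"
      using closure_at g by (simp add: radical_def)
  qed
qed

end
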